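(* Let $S=\{(x,y)\in\mathbb{R}^n\times\mathbb{R}^n:x^Ty=0,\ x\ge0,\ y\ge0\}$ be the complementarity set and let $h:\mathbb{R}^n\times\mathbb{R}^n\to\mathbb{R}$. Assume that $h$ is Lipschitz differentiable and coercive over $S$. Then for sufficiently large $\beta$, the sequence $(\mathbf{x}_0^k,\mathbf{y}^k,w^k)$ generated by ADMM applied to the problem of minimizing $\iota_S(\mathbf{x}_0)+h(\mathbf{y})$ over $\mathbf{x}_0,\mathbf{y}\in\mathbb{R}^{2n}$ subject to $\mathbf{x}_0-\mathbf{y}=0$ has limit points, and all of its limit points are stationary points of the augmented Lagrangian $\mathcal{L}_\beta$.
   Context: $\iota_S$ is the indicator function ($0$ on $S$, $\infty$ elsewhere); inequalities between vectors are componentwise. The problem is a reformulation of minimizing $h(x,y)$ subject to $x^Ty=0$, $x\ge0$, $y\ge0$, with $\mathbf{x}_0=(x',y')$ and $\mathbf{y}=(x,y)$. Coercive over $S$: $h(x,y)\to\infty$ if $(x,y)\in S$ and $\|(x,y)\|\to\infty$. Lipschitz differentiable: differentiable with Lipschitz continuous gradient. Augmented Lagrangian: $\mathcal{L}_\beta(\mathbf{x}_0,\mathbf{y},w)=\iota_S(\mathbf{x}_0)+h(\mathbf{y})+\langle w,\mathbf{x}_0-\mathbf{y}\rangle+\frac{\beta}{2}\|\mathbf{x}_0-\mathbf{y}\|^2$. ADMM: from arbitrary $\mathbf{y}^0,w^0$, for $k=0,1,\dots$: $\mathbf{x}_0^{k+1}\in\operatorname{argmin}_{\mathbf{x}_0}\mathcal{L}_\beta(\mathbf{x}_0,\mathbf{y}^k,w^k)$;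 $\mathbf{y}^{k+1}\in\operatorname{argmin}_{\mathbf{y}}\mathcal{L}_\beta(\mathbf{x}_0^{k+1},\mathbf{y},w^k)$; $w^{k+1}=w^k+\beta(\mathbf{x}_0^{k+1}-\mathbf{y}^{k+1})$. A stationary point is a point where $0\in\partial\mathcal{L}_\beta$, with $\partial$ the general (limiting) subdifferential (Rockafellar–Wets, Def. 8.3). *)

theory Defs
  imports "HOL-Analysis.Analysis"
begin

definition complementarity_set :: "((real ^ 'n) \<times> (real ^ 'n)) set" where
  "complementarity_set = {(x, y). x \<bullet> y = 0 \<and> 0 \<le> x \<and> 0 \<le> y}"

(* The {0, \<infinity>}-valued indicator of convex and variational analysis,
   not the {0, 1}-valued one of the library. *)
definition iota :: "'a set \<Rightarrow> 'a \<Rightarrow> ereal" where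
  "iota S x = (if x \<in> S then 0 else \<infinity>)"

definition lipschitz_differentiable :: "('a::real_inner \<Rightarrow> real) \<Rightarrow> bool" where
  "lipschitz_differentiable h \<longleftrightarrow>
     (\<exists>g L. (\<forall>z. GDERIV h z :> g z) \<and> L-lipschitz_on UNIV g)"

definition coercive_over :: "('a::real_normed_vector \<Rightarrow> real) \<Rightarrow> 'a set \<Rightarrow> bool" where
  "coercive_over h S \<longleftrightarrow> filterlim h at_top (inf at_infinity (principal S))"

text \<open>
  Regular and general (limiting) subdifferentials of an extended-real-valued function
  (Rockafellar and Wets, Variational Analysis, Definition 8.3). The one-sided expansion
  f(z) \<ge> f(x) + v \<bullet> (z - x) + o(norm (z - x)) means by definition that the lower limit below is
  nonnegative. Both sets are empty where f is not finite.
\<close>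

definition regular_subdifferential :: "('a::euclidean_space \<Rightarrow> ereal) \<Rightarrow> 'a \<Rightarrow> 'a set" where
  "regular_subdifferential f x =
     {v. \<bar>f x\<bar> \<noteq> \<infinity> \<and>
         0 \<le> Liminf (at x) (\<lambda>z. (f z - f x - ereal (v \<bullet> (z - x))) / ereal (norm (z - x)))}"

definition subdifferential :: "('a::euclidean_space \<Rightarrow> ereal) \<Rightarrow> 'a \<Rightarrow> 'a set" where
  "subdifferential f x =
     {v. \<bar>f x\<bar> \<noteq> \<infinity> \<and>
         (\<exists>\<xi> \<nu>. \<xi> \<longlonglongrightarrow> x \<and> (\<lambda>k. f (\<xi> k)) \<longlonglongrightarrow> f x \<and>
                (\<forall>k. \<nu> k \<in> regular_subdifferential f (\<xi> k)) \<and> \<nu> \<longlonglongrightarrow> v)}"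

definition stationary_point :: "('a::euclidean_space \<Rightarrow> ereal) \<Rightarrow> 'a \<Rightarrow> bool" where
  "stationary_point f x \<longleftrightarrow> 0 \<in> subdifferential f x"

text \<open>
  The augmented Lagrangian is a function of all three blocks, so that its stationary points are
  taken with respect to the two primal blocks and the multiplier jointly.
\<close>

definition aug_lagrangian ::
    "'a::euclidean_space set \<Rightarrow> ('a \<Rightarrow> real) \<Rightarrow> real \<Rightarrow> 'a \<times> 'a \<times> 'a \<Rightarrow> ereal" where
  "aug_lagrangian S h \<beta> = (\<lambda>(x0, y, w).
     iota S x0 + ereal (h y + w \<bullet> (x0 - y) + \<beta> / 2 * (norm (x0 - y))\<^sup>2))"

text \<open>
  The minimizers need not be unique, so ADMM is a relation. The initial \<open>y 0\<close> and \<open>w 0\<close> are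
  arbitrary; \<open>x0 0\<close> is not produced by the algorithm and is left unconstrained.
\<close>

definition admm_sequence ::
    "'a::euclidean_space set \<Rightarrow> ('a \<Rightarrow> real) \<Rightarrow> real \<Rightarrow>
     (nat \<Rightarrow> 'a) \<Rightarrow> (nat \<Rightarrow> 'a) \<Rightarrow> (nat \<Rightarrow> 'a) \<Rightarrow> bool" where
  "admm_sequence S h \<beta> x0 y w \<longleftrightarrow>
     (\<forall>k. is_arg_min (\<lambda>u. aug_lagrangian S h \<beta> (u, y k, w k)) (\<lambda>_. True) (x0 (Suc k)) \<and>
          is_arg_min (\<lambda>u. aug_lagrangian S h \<beta> (x0 (Suc k), u, w k)) (\<lambda>_. True) (y (Suc k)) \<and>
          w (Suc k) = w k + \<beta> *\<^sub>R (x0 (Suc k) - y (Suc k)))"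

definition limit_point_of :: "(nat \<Rightarrow> 'a::topological_space) \<Rightarrow> 'a \<Rightarrow> bool" where
  "limit_point_of X l \<longleftrightarrow> (\<exists>r. strict_mono r \<and> (X \<circ> r) \<longlonglongrightarrow> l)"

end

theory Submission
  imports Defs
begin

text \<open>
  Let \<open>g\<close> be the gradient of \<open>h\<close> and \<open>L\<close> its Lipschitz constant. The indicator makes the problem
  nonconvex, but it enters the argument only through global minimality in the first block; what
  carries the proof is that the second block is smooth and unconstrained. The optimality condition
  of the \<open>y\<close>-update reads \<open>w = g y\<close> (lemma \<open>multiplier_eq_gradient\<close>), so the multiplier is
  slaved to \<open>y\<close> and moves by at most \<open>L\<close> times the step of \<open>y\<close>.

  This makes the augmented Lagrangian a Lyapunov function. The \<open>x\<close>-update does not increase it; the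
  \<open>y\<close>-update lowers it by \<open>(\<beta> - L) / 2\<close> times the squared \<open>y\<close>-step, since the quadratic penalty
  dominates the possible concavity of \<open>h\<close>; and the ascent in \<open>w\<close> raises it only by
  \<open>L\<^sup>2 / \<beta>\<close> times the same square. For large \<open>\<beta>\<close> the balance is a strict decrease
  (\<open>energy_decrease\<close>). Again because \<open>w = g y\<close>, the value at an iterate is at least \<open>h\<close> at
  the feasible point \<open>x\<close>, plus a multiple of the squared gap between \<open>x\<close> and \<open>y\<close>
  (\<open>energy_lower\<close>). As \<open>h\<close> is coercive over the closed set \<open>S\<close>, the iterates are bounded and the
  energy converges. Hence limit points exist, and the steps of \<open>y\<close> and \<open>w\<close>, together with the gap,
  tend to zero.

  For stationarity, minimality of \<open>x\<close> yields at each iterate an explicit regular subgradient,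
  the residual, built linearly from these vanishing quantities (\<open>residual_regular_subgradient\<close>).
  Along a convergent subsequence the values converge too, because all the points lie in the closed
  set where the indicator vanishes, so the limit \<open>0\<close> is a general subgradient.
\<close>

section \<open>Lipschitz gradients and regular subgradients\<close>

text \<open>
  Subtracting the bound from \<open>h\<close> along the segment leaves a function of one real variable whose
  derivative is nonpositive by Cauchy-Schwarz and the Lipschitz estimate.
\<close>

lemma lipschitz_gradient_upper_bound:
  fixes h :: "'a::real_inner \<Rightarrow> real"
  assumes grad: "\<And>z. GDERIV h z :> g z" and lip: "L-lipschitz_on UNIV g"
  shows "h (z + d) \<le> h z + g z \<bullet> d + L / 2 * (norm d)\<^sup>2"
proof -
  define \<phi> where "\<phi> t = h (z + t *\<^sub>R d) - t * (g z \<bullet> d) - L / 2 * t\<^sup>2 * (norm d)\<^sup>2" for t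
  have "\<phi> 1 \<le> \<phi> 0"
  proof (rule DERIV_nonpos_imp_nonincreasing[of 0 1 \<phi>])
    fix t :: real assume t: "0 \<le> t" "t \<le> 1"
    have line: "((\<lambda>t. z + t *\<^sub>R d) has_derivative (\<lambda>s. s *\<^sub>R d)) (at t)"
      by (auto intro!: derivative_eq_intros)
    have "(h has_derivative (\<lambda>u. u \<bullet> g (z + t *\<^sub>R d))) (at (z + t *\<^sub>R d))"
      using grad[of "z + t *\<^sub>R d"] by (simp add: gderiv_def)
    from has_derivative_compose[OF line this]
    have "((\<lambda>t. h (z + t *\<^sub>R d)) has_real_derivative (g (z + t *\<^sub>R d) \<bullet> d)) (at t)"
      unfolding has_field_derivative_def
      by (rule has_derivative_eq_rhs) (simp add: fun_eq_iff inner_commute mult.commute)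
    then have deriv: "(\<phi> has_real_derivative
        (g (z + t *\<^sub>R d) - g z) \<bullet> d - L * t * (norm d)\<^sup>2) (at t)"
      unfolding \<phi>_def by (auto intro!: derivative_eq_intros simp: inner_diff_left)
    have "(g (z + t *\<^sub>R d) - g z) \<bullet> d \<le> norm (g (z + t *\<^sub>R d) - g z) * norm d"
      by (rule norm_cauchy_schwarz)
    also have "\<dots> \<le> (L * (t * norm d)) * norm d"
      using lipschitz_onD[OF lip, of "z + t *\<^sub>R d" z] t
      by (intro mult_right_mono) (auto simp: dist_norm)
    finally show "\<exists>l. (\<phi> has_real_derivative l) (at t) \<and> l \<le> 0"
      using deriv by (intro exI[of _ "(g (z + t *\<^sub>R d) - g z) \<bullet> d - L * t * (norm d)\<^sup>2"])
        (simp add: power2_eq_square mult.assoc)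
  qed simp
  then show ?thesis by (simp add: \<phi>_def)
qed

lemma lipschitz_gradient_lower_bound:
  fixes h :: "'a::real_inner \<Rightarrow> real"
  assumes grad: "\<And>z. GDERIV h z :> g z" and lip: "L-lipschitz_on UNIV g"
  shows "h z + g z \<bullet> d - L / 2 * (norm d)\<^sup>2 \<le> h (z + d)"
proof -
  have "GDERIV (\<lambda>z. - h z) z :> - g z" for z
    by (rule GDERIV_minus[OF grad])
  moreover have "L-lipschitz_on UNIV (\<lambda>z. - g z)"
    using lip by (simp add: lipschitz_on_def dist_minus)
  ultimately show ?thesis
    using lipschitz_gradient_upper_bound[of "\<lambda>z. - h z" "\<lambda>z. - g z" L z d] by simp
qed

text \<open>
  A quadratic error is \<open>o(norm (z - x))\<close>. Because everything but the indicator is quadratic up to the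
  bounds above, minorants of this kind give all the regular subgradients needed, and no sum rule for
  subdifferentials has to be invoked.
\<close>

lemma regular_subgradient_of_quadratic_minorant:
  fixes f :: "'a::euclidean_space \<Rightarrow> ereal"
  assumes fin: "\<bar>f x\<bar> \<noteq> \<infinity>"
    and minorant: "\<And>z. f x + ereal (v \<bullet> (z - x) - C * (norm (z - x))\<^sup>2) \<le> f z"
  shows "v \<in> regular_subdifferential f x"
proof -
  let ?q = "\<lambda>z. (f z - f x - ereal (v \<bullet> (z - x))) / ereal (norm (z - x))"
  obtain a where a: "f x = ereal a" using fin by auto
  have "((\<lambda>z. - C * norm (z - x)) \<longlongrightarrow> - C * norm (x - x)) (at x)"
    by (intro tendsto_intros)
  then have "((\<lambda>z. ereal (- C * norm (z - x))) \<longlongrightarrow> 0) (at x)"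
    by (simp add: zero_ereal_def)
  then have "Liminf (at x) (\<lambda>z. ereal (- C * norm (z - x))) = 0"
    by (intro lim_imp_Liminf) auto
  moreover have "ereal (- C * norm (z - x)) \<le> ?q z" if "z \<noteq> x" for z
  proof (cases "f z")
    case (real b)
    have n: "norm (z - x) > 0" using that by simp
    have "- C * norm (z - x) * norm (z - x) \<le> b - a - v \<bullet> (z - x)"
      using minorant[of z] real a by (simp add: power2_eq_square algebra_simps)
    then have "- C * norm (z - x) \<le> (b - a - v \<bullet> (z - x)) / norm (z - x)"
      using n by (simp add: pos_le_divide_eq)
    then show ?thesis using real a n by simp
  next
    case PInf
    then show ?thesis using that a by simp
  next
    case MInf
    then show ?thesis using minorant[of z] a by simp
  qed
  then have "Liminf (at x) (\<lambda>z. ereal (- C * norm (z - x))) \<le> Liminf (at x) ?q"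
    by (intro Liminf_mono) (auto simp: eventually_at_filter)
  ultimately show ?thesis using fin by (simp add: regular_subdifferential_def)
qed

section \<open>Coercivity and bounded sequences\<close>

lemma coercive_over_bounded_sublevel:
  assumes "coercive_over h S"
  shows "bounded {u \<in> S. h u \<le> c}"
proof -
  have "eventually (\<lambda>u. c < h u) (inf at_infinity (principal S))"
    using assms by (simp add: coercive_over_def filterlim_at_top_dense)
  then obtain b where "\<And>u. norm u \<ge> b \<Longrightarrow> u \<in> S \<Longrightarrow> c < h u"
    by (auto simp: eventually_inf_principal eventually_at_infinity)
  then show ?thesis by (intro boundedI[of _ b]) (force simp: not_less)
qed

text \<open>
  On \<open>S\<close> the function is positive outside its sublevel set of height \<open>0\<close>, and the closure of that bounded
  set is compact. The closure is taken in the whole space, where \<open>h\<close> is still continuous.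
\<close>

lemma coercive_over_bdd_below:
  fixes h :: "'a::euclidean_space \<Rightarrow> real"
  assumes coer: "coercive_over h S" and cont: "continuous_on UNIV h"
  shows "\<exists>m. \<forall>u\<in>S. m \<le> h u"
proof -
  have "compact (closure {u \<in> S. h u \<le> 0})"
    using coercive_over_bounded_sublevel[OF coer] by simp
  then have "compact (h ` closure {u \<in> S. h u \<le> 0})"
    by (intro compact_continuous_image continuous_on_subset[OF cont]) auto
  then obtain b where b: "\<And>t. t \<in> h ` closure {u \<in> S. h u \<le> 0} \<Longrightarrow> \<bar>t\<bar> \<le> b"
    using compact_imp_bounded bounded_real by metis
  have "min 0 (- b) \<le> h u" if "u \<in> S" for u
  proof (cases "h u \<le> 0")
    case True
    then have "u \<in> closure {u \<in> S. h u \<le> 0}" using that closure_subset by fastforce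
    then show ?thesis using b[of "h u"] by auto
  qed simp
  then show ?thesis by blast
qed

text \<open>
  Only the tail is controlled, since the first element of an ADMM run is arbitrary.
\<close>

lemma limit_point_of_bounded_tail:
  fixes X :: "nat \<Rightarrow> 'a::euclidean_space"
  assumes "bounded (range (\<lambda>k. X (Suc k)))"
  obtains p where "limit_point_of X p"
proof -
  obtain p r where r: "strict_mono r" "((\<lambda>k. X (Suc k)) \<circ> r) \<longlonglongrightarrow> p"
    using bounded_imp_convergent_subsequence[OF assms] by metis
  have "strict_mono (Suc \<circ> r)" using r(1) by (simp add: strict_mono_def)
  moreover have "(X \<circ> (Suc \<circ> r)) \<longlonglongrightarrow> p" using r(2) by (simp add: o_def)
  ultimately show thesis using that limit_point_of_def by blast
qed

section \<open>The smooth part of the augmented Lagrangian\<close>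

definition smooth_lagrangian ::
    "('a::euclidean_space \<Rightarrow> real) \<Rightarrow> real \<Rightarrow> 'a \<Rightarrow> 'a \<Rightarrow> 'a \<Rightarrow> real" where
  "smooth_lagrangian h \<beta> u v w = h v + w \<bullet> (u - v) + \<beta> / 2 * (norm (u - v))\<^sup>2"

lemma aug_lagrangian_eq:
  "aug_lagrangian S h \<beta> (u, v, w) =
     (if u \<in> S then ereal (smooth_lagrangian h \<beta> u v w) else \<infinity>)"
  by (simp add: aug_lagrangian_def iota_def smooth_lagrangian_def)

lemma smooth_lagrangian_x_step:
  "smooth_lagrangian h \<beta> (u + a) v w =
     smooth_lagrangian h \<beta> u v w + (w + \<beta> *\<^sub>R (u - v)) \<bullet> a + \<beta> / 2 * (norm a)\<^sup>2"
  unfolding smooth_lagrangian_def power2_norm_eq_inner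
  by (simp add: algebra_simps inner_simps inner_commute)

lemma smooth_lagrangian_y_step:
  "smooth_lagrangian h \<beta> u (v + b) w =
     smooth_lagrangian h \<beta> u v w + (h (v + b) - h v) - (w + \<beta> *\<^sub>R (u - v)) \<bullet> b
       + \<beta> / 2 * (norm b)\<^sup>2"
  unfolding smooth_lagrangian_def power2_norm_eq_inner
  by (simp add: algebra_simps inner_simps inner_commute)

section \<open>Convergence of ADMM over a closed set\<close>

text \<open>
  The threshold on \<open>\<beta>\<close> is a convenient one for which the balance of the three updates is a
  decrease of at least half the squared step, independently of \<open>L\<close>.
\<close>

locale admm_run =
  fixes S :: "'a::euclidean_space set" and h :: "'a \<Rightarrow> real" and g :: "'a \<Rightarrow> 'a"
    and L \<beta> :: real and x y w :: "nat \<Rightarrow> 'a"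
  assumes closed: "closed S" and nonempty: "S \<noteq> {}"
    and grad: "GDERIV h z :> g z" and lip: "L-lipschitz_on UNIV g"
    and coercive: "coercive_over h S"
    and large: "2 * L + 1 \<le> \<beta>"
    and admm: "admm_sequence S h \<beta> x y w"
begin

abbreviation (input) \<L> where "\<L> \<equiv> smooth_lagrangian h \<beta>"

lemma L_nonneg: "0 \<le> L"
  using lip by (rule lipschitz_on_nonneg)

lemma beta_pos: "0 < \<beta>"
  using L_nonneg large by linarith

lemmas upper = lipschitz_gradient_upper_bound[OF grad lip]
lemmas lower = lipschitz_gradient_lower_bound[OF grad lip]

lemma continuous_h: "continuous_on UNIV h"
  using grad by (auto simp: gderiv_def intro!: has_derivative_continuous
      continuous_at_imp_continuous_on)

lemma continuous_g: "continuous_on UNIV g"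
  using lip by (rule lipschitz_on_continuous_on)

lemma w_Suc: "w (Suc k) = w k + \<beta> *\<^sub>R (x (Suc k) - y (Suc k))"
  using admm by (simp add: admm_sequence_def)

lemma x_in_S: "x (Suc k) \<in> S"
proof (rule ccontr)
  assume "x (Suc k) \<notin> S"
  moreover obtain s where "s \<in> S" using nonempty by blast
  ultimately have "aug_lagrangian S h \<beta> (s, y k, w k) < aug_lagrangian S h \<beta> (x (Suc k), y k, w k)"
    by (simp add: aug_lagrangian_eq)
  then show False using admm by (auto simp: admm_sequence_def is_arg_min_def)
qed

lemma x_minimizes: "u \<in> S \<Longrightarrow> \<L> (x (Suc k)) (y k) (w k) \<le> \<L> u (y k) (w k)"
proof -
  assume u: "u \<in> S"
  have "\<not> aug_lagrangian S h \<beta> (u, y k, w k) < aug_lagrangian S h \<beta> (x (Suc k), y k, w k)"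
    using admm by (auto simp: admm_sequence_def is_arg_min_def)
  then show ?thesis using u x_in_S[of k] by (simp add: aug_lagrangian_eq)
qed

lemma y_minimizes: "\<L> (x (Suc k)) (y (Suc k)) (w k) \<le> \<L> (x (Suc k)) u (w k)"
proof -
  have "\<not> aug_lagrangian S h \<beta> (x (Suc k), u, w k)
        < aug_lagrangian S h \<beta> (x (Suc k), y (Suc k), w k)"
    using admm by (auto simp: admm_sequence_def is_arg_min_def)
  then show ?thesis using x_in_S[of k] by (simp add: aug_lagrangian_eq)
qed

text \<open>
  The multiplier update is made so that the gradient of the \<open>y\<close>-subproblem at its minimizer is
  \<open>g y - w\<close> with the new multiplier \<open>w\<close>. A gradient step from the minimizer would lower the value
  if this vector were nonzero.
\<close>

lemma multiplier_eq_gradient: "w (Suc k) = g (y (Suc k))"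
proof -
  define v where "v = g (y (Suc k)) - w (Suc k)"
  \<comment> \<open>The step length minimizing the quadratic upper bound on the subproblem, whose curvature is
    \<open>L + \<beta>\<close>.\<close>
  define t where "t = 1 / (L + \<beta>)"
  have t: "t > 0" "(L + \<beta>) * t = 1"
    using L_nonneg beta_pos by (auto simp: t_def)
  have "0 \<le> (h (y (Suc k) + - t *\<^sub>R v) - h (y (Suc k)))
      - w (Suc k) \<bullet> (- t *\<^sub>R v) + \<beta> / 2 * (norm (- t *\<^sub>R v))\<^sup>2"
    using y_minimizes[of k "y (Suc k) + - t *\<^sub>R v"]
    unfolding smooth_lagrangian_y_step w_Suc by linarith
  also have "\<dots> \<le> v \<bullet> (- t *\<^sub>R v) + (L + \<beta>) / 2 * (norm (- t *\<^sub>R v))\<^sup>2"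
    using upper[of "y (Suc k)" "- t *\<^sub>R v"]
    by (simp add: v_def algebra_simps inner_simps add_divide_distrib)
  also have "\<dots> = (((L + \<beta>) * t) / 2 - 1) * (t * (norm v)\<^sup>2)"
  proof -
    have "v \<bullet> (- t *\<^sub>R v) = - t * (norm v)\<^sup>2" "(norm (- t *\<^sub>R v))\<^sup>2 = t * t * (norm v)\<^sup>2"
      by (simp_all add: power2_norm_eq_inner power_mult_distrib) (simp add: power2_eq_square)
    then show ?thesis by (simp only:) (simp add: algebra_simps)
  qed
  also have "\<dots> = - (t / 2) * (norm v)\<^sup>2"
    unfolding t(2) by simp
  finally have "(norm v)\<^sup>2 \<le> 0" using t(1) by (simp add: mult_le_0_iff)
  then show ?thesis by (simp add: v_def)
qed

lemma multiplier_step: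
  "norm (w (Suc (Suc k)) - w (Suc k)) \<le> L * norm (y (Suc (Suc k)) - y (Suc k))"
  using lipschitz_onD[OF lip, of "y (Suc (Suc k))" "y (Suc k)"]
  by (simp add: multiplier_eq_gradient dist_norm)

text \<open>
  The index is shifted because the point with index \<open>0\<close> need not be feasible, nor its multiplier a
  gradient.
\<close>

definition energy :: "nat \<Rightarrow> real" where
  "energy k = \<L> (x (Suc k)) (y (Suc k)) (w (Suc k))"

text \<open>
  The three facts \<open>xs\<close>, \<open>ys\<close> and \<open>ws\<close> bound the change in the three updates. Ascent in the
  multiplier costs \<open>(norm (w' - w))\<^sup>2 / \<beta>\<close>, which the gain in the \<open>y\<close>-update pays for because the
  multiplier is a Lipschitz function of \<open>y\<close>.
\<close>

lemma energy_decrease: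
  "energy (Suc k) + 1 / 2 * (norm (y (Suc (Suc k)) - y (Suc k)))\<^sup>2 \<le> energy k"
proof -
  let ?j = "Suc k" and ?k = "Suc (Suc k)"
  define b where "b = y ?j - y ?k"
  have b_norm: "norm (y ?k - y ?j) = norm b"
    by (simp add: b_def norm_minus_commute)
  have yj: "y ?j = y ?k + b" by (simp add: b_def)
  have xs: "\<L> (x ?k) (y ?j) (w ?j) \<le> energy k"
    unfolding energy_def by (rule x_minimizes[OF x_in_S])
  have "\<L> (x ?k) (y ?j) (w ?j) = \<L> (x ?k) (y ?k) (w ?j) + (h (y ?k + b) - h (y ?k))
      - g (y ?k) \<bullet> b + \<beta> / 2 * (norm b)\<^sup>2"
    unfolding yj smooth_lagrangian_y_step
    by (simp only: w_Suc[of ?j, symmetric] multiplier_eq_gradient[of ?j])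
  then have ys: "\<L> (x ?k) (y ?k) (w ?j) + (\<beta> - L) / 2 * (norm b)\<^sup>2 \<le> \<L> (x ?k) (y ?j) (w ?j)"
    using lower[of "y ?k" b] by (simp add: left_diff_distrib diff_divide_distrib)
  have gap: "x ?k - y ?k = (1 / \<beta>) *\<^sub>R (w ?k - w ?j)"
    using w_Suc[of ?j] beta_pos by simp
  have "energy (Suc k) = \<L> (x ?k) (y ?k) (w ?j) + (w ?k - w ?j) \<bullet> (x ?k - y ?k)"
    by (simp add: energy_def smooth_lagrangian_def inner_simps)
  also have "\<dots> = \<L> (x ?k) (y ?k) (w ?j) + (norm (w ?k - w ?j))\<^sup>2 / \<beta>"
    unfolding gap by (simp add: power2_norm_eq_inner)
  also have "(norm (w ?k - w ?j))\<^sup>2 / \<beta> \<le> (L * norm b)\<^sup>2 / \<beta>"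
    using multiplier_step[of k] beta_pos by (intro divide_right_mono power_mono) (auto simp: b_norm)
  finally have ws: "energy (Suc k) \<le> \<L> (x ?k) (y ?k) (w ?j) + L\<^sup>2 / \<beta> * (norm b)\<^sup>2"
    by (simp add: power_mult_distrib)
  \<comment> \<open>Both factors come from \<open>2 * L + 1 \<le> \<beta>\<close>, and \<open>\<beta> - 1\<close> in one of them is what
    brings the net decrease up to \<open>1 / 2\<close>.\<close>
  have "L * L \<le> ((\<beta> - 1) / 2) * (\<beta> / 2)"
    using L_nonneg large by (intro mult_mono) auto
  then have "L\<^sup>2 / \<beta> \<le> (\<beta> - 1) / 4"
    using beta_pos by (simp add: pos_divide_le_eq power2_eq_square)
  then have "1 / 2 \<le> (\<beta> - L) / 2 - L\<^sup>2 / \<beta>"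
    using large by argo
  then have "1 / 2 * (norm b)\<^sup>2 \<le> ((\<beta> - L) / 2 - L\<^sup>2 / \<beta>) * (norm b)\<^sup>2"
    by (rule mult_right_mono) simp
  then show ?thesis
    using xs ys ws unfolding b_norm left_diff_distrib by linarith
qed

text \<open>
  With \<open>w = g y\<close> the multiplier term is the linear part of the expansion of \<open>h\<close> at \<open>y\<close>, so
  the value is \<open>h x\<close> up to a quadratic error that the penalty absorbs.
\<close>

lemma energy_lower:
  "h (x (Suc k)) + 1 / 2 * (norm (x (Suc k) - y (Suc k)))\<^sup>2 \<le> energy k"
proof -
  let ?d = "x (Suc k) - y (Suc k)"
  have "h (x (Suc k)) \<le> h (y (Suc k)) + g (y (Suc k)) \<bullet> ?d + L / 2 * (norm ?d)\<^sup>2"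
    using upper[of "y (Suc k)" ?d] by simp
  moreover have "1 / 2 * (norm ?d)\<^sup>2 \<le> (\<beta> - L) / 2 * (norm ?d)\<^sup>2"
    using large L_nonneg by (intro mult_right_mono) auto
  ultimately show ?thesis
    by (simp add: energy_def smooth_lagrangian_def multiplier_eq_gradient left_diff_distrib
        diff_divide_distrib)
qed

lemma h_le_energy: "h (x (Suc k)) \<le> energy k"
  by (rule order_trans[OF _ energy_lower]) simp

lemma decseq_energy: "decseq energy"
proof (rule decseq_SucI)
  show "energy (Suc k) \<le> energy k" for k
    by (rule order_trans[OF _ energy_decrease]) simp
qed

text \<open>
  Coercivity bounds only the feasible block \<open>x\<close>; the gap bound carries this over to \<open>y\<close>, and
  continuity of \<open>g\<close> to \<open>w\<close>.
\<close>

lemma bounded_iterates: "bounded (range (\<lambda>k. (x (Suc k), y (Suc k), w (Suc k))))"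
proof -
  obtain m where m: "\<forall>u\<in>S. m \<le> h u"
    using coercive_over_bdd_below[OF coercive continuous_h] by blast
  have top: "energy k \<le> energy 0" for k
    using decseq_energy by (simp add: decseq_def)
  have "range (\<lambda>k. x (Suc k)) \<subseteq> {u \<in> S. h u \<le> energy 0}"
  proof safe
    fix k
    show "x (Suc k) \<in> S" by (rule x_in_S)
    show "h (x (Suc k)) \<le> energy 0"
      using h_le_energy top by (rule order_trans)
  qed
  then have bx: "bounded (range (\<lambda>k. x (Suc k)))"
    by (rule bounded_subset[OF coercive_over_bounded_sublevel[OF coercive]])
  have "norm (x (Suc k) - y (Suc k)) \<le> sqrt (2 * (energy 0 - m))" for k
    using energy_lower[of k] top[of k] bspec[OF m x_in_S[of k]] by (intro real_le_rsqrt) simp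
  then have "bounded (range (\<lambda>k. x (Suc k) - y (Suc k)))"
    by (intro boundedI) auto
  from bounded_minus_comp[OF bx this] have by_bounded: "bounded (range (\<lambda>k. y (Suc k)))" by simp
  have "compact (g ` closure (range (\<lambda>k. y (Suc k))))"
    using by_bounded continuous_on_subset[OF continuous_g subset_UNIV]
    by (intro compact_continuous_image) simp_all
  moreover have "range (\<lambda>k. w (Suc k)) \<subseteq> g ` closure (range (\<lambda>k. y (Suc k)))"
    using closure_subset[of "range (\<lambda>k. y (Suc k))"] by (auto simp: multiplier_eq_gradient)
  ultimately have "bounded (range (\<lambda>k. w (Suc k)))"
    by (intro bounded_subset[OF compact_imp_bounded])
  from bounded_Times[OF bx bounded_Times[OF by_bounded this]] show ?thesis
    by (rule bounded_subset) auto
qed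

lemma y_steps_vanish: "(\<lambda>k. y (Suc (Suc k)) - y (Suc k)) \<longlonglongrightarrow> 0"
proof -
  obtain m where m: "\<forall>u\<in>S. m \<le> h u"
    using coercive_over_bdd_below[OF coercive continuous_h] by blast
  have "m \<le> energy k" for k
    using bspec[OF m x_in_S] h_le_energy by (rule order_trans)
  then have "bdd_below (range energy)" unfolding bdd_below_def by auto
  then obtain l where l: "energy \<longlonglongrightarrow> l"
    using LIMSEQ_decseq_INF[OF _ decseq_energy] by blast
  then have "(\<lambda>k. 2 * (energy k - energy (Suc k))) \<longlonglongrightarrow> 2 * (l - l)"
    by (intro tendsto_intros LIMSEQ_Suc)
  then have "(\<lambda>k. 2 * (energy k - energy (Suc k))) \<longlonglongrightarrow> 0" by simp
  moreover have "(norm (y (Suc (Suc k)) - y (Suc k)))\<^sup>2 \<le> 2 * (energy k - energy (Suc k))" for k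
    using energy_decrease[of k] by simp
  ultimately have "(\<lambda>k. (norm (y (Suc (Suc k)) - y (Suc k)))\<^sup>2) \<longlonglongrightarrow> 0"
    by - (rule Lim_null_comparison[where g = "\<lambda>k. 2 * (energy k - energy (Suc k))"], simp_all)
  from tendsto_real_sqrt[OF this] show ?thesis
    by (simp add: tendsto_norm_zero_iff)
qed

lemma w_steps_vanish: "(\<lambda>k. w (Suc (Suc k)) - w (Suc k)) \<longlonglongrightarrow> 0"
proof (rule Lim_null_comparison)
  show "\<forall>\<^sub>F k in sequentially. norm (w (Suc (Suc k)) - w (Suc k))
      \<le> L * norm (y (Suc (Suc k)) - y (Suc k))"
    using multiplier_step by simp
  show "(\<lambda>k. L * norm (y (Suc (Suc k)) - y (Suc k))) \<longlonglongrightarrow> 0"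
    using tendsto_mult_right_zero[OF tendsto_norm_zero[OF y_steps_vanish]] .
qed

lemma gap_vanishes: "(\<lambda>k. x (Suc (Suc k)) - y (Suc (Suc k))) \<longlonglongrightarrow> 0"
proof -
  have "(\<lambda>k. (1 / \<beta>) *\<^sub>R (w (Suc (Suc k)) - w (Suc k))) \<longlonglongrightarrow> (1 / \<beta>) *\<^sub>R 0"
    by (intro tendsto_intros w_steps_vanish)
  moreover have "(1 / \<beta>) *\<^sub>R (w (Suc (Suc k)) - w (Suc k)) = x (Suc (Suc k)) - y (Suc (Suc k))" for k
    using w_Suc[of "Suc k"] beta_pos by simp
  ultimately show ?thesis by simp
qed

text \<open>
  This is the gradient of the smooth part at the new iterate, plus the element
  \<open>- w k - \<beta> *\<^sub>R (x (Suc k) - y k)\<close> of the normal cone to \<open>S\<close> that the optimality of the \<open>x\<close>-update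
  provides. In the second component \<open>g y - w\<close> has cancelled.
\<close>

definition residual :: "nat \<Rightarrow> 'a \<times> 'a \<times> 'a" where
  "residual k =
     ((w (Suc k) - w k) - \<beta> *\<^sub>R (y (Suc k) - y k),
      - \<beta> *\<^sub>R (x (Suc k) - y (Suc k)),
      x (Suc k) - y (Suc k))"

text \<open>
  The smooth part exceeds its linearization up to a quadratic error. When \<open>a\<close> leads from \<open>x\<close> to
  another point of \<open>S\<close>, the normal vector in the residual is harmless because minimality of \<open>x\<close>
  bounds its product with \<open>a\<close> by \<open>\<beta> / 2 * (norm a)\<^sup>2\<close>.
\<close>

lemma residual_regular_subgradient:
  "residual k \<in> regular_subdifferential (aug_lagrangian S h \<beta>) (x (Suc k), y (Suc k), w (Suc k))"
proof -
  let ?x = "x (Suc k)" and ?y = "y (Suc k)" and ?w = "w (Suc k)"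
  let ?C = "\<beta> / 2 + L / 2 + 1"
  have quad: "\<L> ?x ?y ?w + (residual k \<bullet> (a, b, c) - ?C * (norm (a, b, c))\<^sup>2)
      \<le> \<L> (?x + a) (?y + b) (?w + c)"
    if a: "?x + a \<in> S" for a b c
  proof -
    have opt: "- ((w k + \<beta> *\<^sub>R (?x - y k)) \<bullet> a) \<le> \<beta> / 2 * (norm a)\<^sup>2"
      using x_minimizes[OF a, of k] unfolding smooth_lagrangian_x_step by simp
    have "\<L> (?x + a) (?y + b) (?w + c)
        = \<L> ?x ?y ?w + (h (?y + b) - h ?y) + (?w + \<beta> *\<^sub>R (?x - ?y)) \<bullet> (a - b)
          + c \<bullet> (?x - ?y) + c \<bullet> (a - b) + \<beta> / 2 * (norm (a - b))\<^sup>2"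
      unfolding smooth_lagrangian_def power2_norm_eq_inner
      by (simp add: algebra_simps inner_simps inner_commute)
    moreover have "g ?y \<bullet> b - L / 2 * (norm b)\<^sup>2 \<le> h (?y + b) - h ?y"
      using lower[of ?y b] by simp
    moreover have "residual k \<bullet> (a, b, c) = (?w + \<beta> *\<^sub>R (?x - ?y)) \<bullet> (a - b) + c \<bullet> (?x - ?y)
        + g ?y \<bullet> b - (w k + \<beta> *\<^sub>R (?x - y k)) \<bullet> a"
      unfolding residual_def multiplier_eq_gradient[symmetric]
      by (simp add: algebra_simps inner_simps inner_commute)
    moreover have "- ((norm a)\<^sup>2 + (norm b)\<^sup>2 + (norm c)\<^sup>2) \<le> c \<bullet> (a - b)"
    proof -
      \<comment> \<open>Young's inequality for the bilinear coupling of the multiplier with the gap.\<close>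
      have "0 \<le> (norm (c + a))\<^sup>2 + (norm (c - b))\<^sup>2 + (norm a)\<^sup>2 + (norm b)\<^sup>2" by simp
      then show ?thesis
        unfolding power2_norm_eq_inner by (simp add: inner_simps inner_commute)
    qed
    moreover have "0 \<le> \<beta> / 2 * (norm (a - b))\<^sup>2"
      using beta_pos by simp
    moreover have "\<beta> / 2 * (norm a)\<^sup>2 + L / 2 * (norm b)\<^sup>2 + ((norm a)\<^sup>2 + (norm b)\<^sup>2 + (norm c)\<^sup>2)
        \<le> ?C * (norm (a, b, c))\<^sup>2"
    proof -
      have "(norm (a, b, c))\<^sup>2 = (norm a)\<^sup>2 + (norm b)\<^sup>2 + (norm c)\<^sup>2"
        by (simp add: norm_Pair)
      moreover have "0 \<le> \<beta> / 2 * ((norm b)\<^sup>2 + (norm c)\<^sup>2)" "0 \<le> L / 2 * ((norm a)\<^sup>2 + (norm c)\<^sup>2)"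
        using beta_pos L_nonneg by simp_all
      ultimately show ?thesis by (simp add: algebra_simps)
    qed
    ultimately show ?thesis using opt by linarith
  qed
  show ?thesis
  proof (rule regular_subgradient_of_quadratic_minorant[where C = ?C])
    show "\<bar>aug_lagrangian S h \<beta> (?x, ?y, ?w)\<bar> \<noteq> \<infinity>"
      using x_in_S[of k] by (simp add: aug_lagrangian_eq)
    fix z :: "'a \<times> 'a \<times> 'a"
    obtain u v q where z: "z = (u, v, q)" by (cases z)
    show "aug_lagrangian S h \<beta> (?x, ?y, ?w) + ereal (residual k \<bullet> (z - (?x, ?y, ?w))
        - ?C * (norm (z - (?x, ?y, ?w)))\<^sup>2) \<le> aug_lagrangian S h \<beta> z"
      using quad[of "u - ?x" "v - ?y" "q - ?w"] x_in_S[of k]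
      by (simp add: z aug_lagrangian_eq)
  qed
qed

lemma residual_vanishes: "(\<lambda>k. residual (Suc k)) \<longlonglongrightarrow> 0"
proof -
  have "(\<lambda>k. residual (Suc k)) \<longlonglongrightarrow> (0 - \<beta> *\<^sub>R 0, - \<beta> *\<^sub>R 0, 0)"
    unfolding residual_def
    by (intro tendsto_intros w_steps_vanish y_steps_vanish gap_vanishes)
  then show ?thesis by (simp add: zero_prod_def)
qed

theorem limit_point_exists: "\<exists>p. limit_point_of (\<lambda>k. (x k, y k, w k)) p"
  using limit_point_of_bounded_tail[of "\<lambda>k. (x k, y k, w k)"] bounded_iterates by blast

theorem limit_point_stationary:
  assumes "limit_point_of (\<lambda>k. (x k, y k, w k)) p"
  shows "stationary_point (aug_lagrangian S h \<beta>) p"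
proof -
  obtain r where r: "strict_mono r" and "((\<lambda>k. (x k, y k, w k)) \<circ> r) \<longlonglongrightarrow> p"
    using assms by (auto simp: limit_point_of_def)
  then have lim0: "(\<lambda>k. (x (r k), y (r k), w (r k))) \<longlonglongrightarrow> p" by (simp add: o_def)
  \<comment> \<open>The multiplier step is controlled by \<open>L\<close> only from the second iterate on, so the subsequence is
    shifted by two; then its indices have the form \<open>Suc (Suc (s k))\<close>.\<close>
  define s where "s k = r (k + 2) - 2" for k
  have s: "r (k + 2) = Suc (Suc (s k))" for k
    using seq_suble[OF r, of "k + 2"] by (simp add: s_def)
  have "strict_mono s"
  proof (rule strict_monoI)
    fix j k :: nat assume "j < k"
    then have "r (j + 2) < r (k + 2)" using r by (simp add: strict_mono_def)
    then show "s j < s k" unfolding s by simp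
  qed
  then have res: "(\<lambda>k. residual (Suc (s k))) \<longlonglongrightarrow> 0"
    using LIMSEQ_subseq_LIMSEQ[OF residual_vanishes] by (simp add: o_def)
  let ?\<xi> = "\<lambda>k. (x (Suc (Suc (s k))), y (Suc (Suc (s k))), w (Suc (Suc (s k))))"
  have lim: "?\<xi> \<longlonglongrightarrow> p"
    using LIMSEQ_ignore_initial_segment[OF lim0, of 2] unfolding s .
  obtain u v q where p: "p = (u, v, q)" by (cases p)
  have cx: "(\<lambda>k. x (Suc (Suc (s k)))) \<longlonglongrightarrow> u"
    using tendsto_fst[OF lim] by (simp add: p)
  have cy: "(\<lambda>k. y (Suc (Suc (s k)))) \<longlonglongrightarrow> v"
    using tendsto_fst[OF tendsto_snd[OF lim]] by (simp add: p)
  have cw: "(\<lambda>k. w (Suc (Suc (s k)))) \<longlonglongrightarrow> q"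
    using tendsto_snd[OF tendsto_snd[OF lim]] by (simp add: p)
  have u: "u \<in> S"
    using closed_sequentially[OF closed _ cx] x_in_S by blast
  have "(\<lambda>k. h (y (Suc (Suc (s k))))) \<longlonglongrightarrow> h v"
    by (rule continuous_on_tendsto_compose[OF continuous_h cy]) auto
  then have "(\<lambda>k. \<L> (x (Suc (Suc (s k)))) (y (Suc (Suc (s k)))) (w (Suc (Suc (s k))))) \<longlonglongrightarrow> \<L> u v q"
    unfolding smooth_lagrangian_def by (intro tendsto_intros cx cy cw)
  then have val: "(\<lambda>k. aug_lagrangian S h \<beta> (?\<xi> k)) \<longlonglongrightarrow> aug_lagrangian S h \<beta> p"
    using u x_in_S by (simp add: p aug_lagrangian_eq)
  show ?thesis
    unfolding stationary_point_def subdifferential_def mem_Collect_eq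
  proof (intro conjI exI allI)
    show "\<bar>aug_lagrangian S h \<beta> p\<bar> \<noteq> \<infinity>" using u by (simp add: p aug_lagrangian_eq)
  qed (fact lim val res residual_regular_subgradient)+
qed

end

section \<open>The complementarity set\<close>

lemma closed_complementarity_set:
  "closed (complementarity_set :: ((real ^ 'n) \<times> (real ^ 'n)) set)"
proof -
  have "complementarity_set = {p :: (real ^ 'n) \<times> (real ^ 'n). fst p \<bullet> snd p = 0}
      \<inter> (\<Inter>i. {p. 0 \<le> fst p $ i}) \<inter> (\<Inter>i. {p. 0 \<le> snd p $ i})"
    by (auto simp: complementarity_set_def less_eq_vec_def)
  also have "closed \<dots>"
    by (intro closed_Int closed_INT ballI closed_Collect_eq closed_Collect_le continuous_intros)
  finally show ?thesis .
qed

theorem corollary3: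
  fixes h :: "(real ^ 'n) \<times> (real ^ 'n) \<Rightarrow> real"
  assumes "lipschitz_differentiable h"
    and "coercive_over h complementarity_set"
  shows "\<forall>\<^sub>F \<beta> in at_top. \<forall>x0 y w.
    admm_sequence complementarity_set h \<beta> x0 y w \<longrightarrow>
      (\<exists>p. limit_point_of (\<lambda>k. (x0 k, y k, w k)) p) \<and>
      (\<forall>p. limit_point_of (\<lambda>k. (x0 k, y k, w k)) p \<longrightarrow>
           stationary_point (aug_lagrangian complementarity_set h \<beta>) p)"
proof -
  obtain g L where g: "\<And>z. GDERIV h z :> g z" "L-lipschitz_on UNIV g"
    using assms(1) by (auto simp: lipschitz_differentiable_def)
  have "(0, 0) \<in> (complementarity_set :: ((real ^ 'n) \<times> (real ^ 'n)) set)"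
    by (simp add: complementarity_set_def)
  then have nonempty: "(complementarity_set :: ((real ^ 'n) \<times> (real ^ 'n)) set) \<noteq> {}" by blast
  show ?thesis
    using eventually_ge_at_top[of "2 * L + 1"]
  proof eventually_elim
    case (elim \<beta>)
    show ?case
    proof (intro allI impI)
      fix x0 y w :: "nat \<Rightarrow> (real ^ 'n) \<times> (real ^ 'n)"
      assume "admm_sequence complementarity_set h \<beta> x0 y w"
      then interpret admm_run complementarity_set h g L \<beta> x0 y w
        using closed_complementarity_set nonempty g assms(2) elim by unfold_locales
      show "(\<exists>p. limit_point_of (\<lambda>k. (x0 k, y k, w k)) p) \<and>
          (\<forall>p. limit_point_of (\<lambda>k. (x0 k, y k, w k)) p \<longrightarrow>
             stationary_point (aug_lagrangian complementarity_set h \<beta>) p)"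
        using limit_point_exists limit_point_stationary by blast
    qed
  qed
qed

end
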